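(* Let $P:=R_1\cup\ldots\cup R_n$ be a well-typed general logic program such that $R_n\sqsupset\ldots\sqsupset R_1$ is a hierarchy, and let $|\ |_1,\ldots,|\ |_n$ be level mappings for $R_1,\ldots,R_n$, respectively. Suppose that for every well-typed atom $A$ and every $i\in\{1,\ldots,n\}$, if $A$ is defined in $R_i$ then $A$ is bounded with respect to $|\ |_i$. Then every well-typed query is strongly bounded with respect to $P$ and $|\ |_1,\ldots,|\ |_n$.
   Context: **Programs.** All programs and queries are over a fixed first-order language with at least one constant. A literal is an atom or a negated atom. A (general) clause is $H\leftarrow L_1,\ldots,L_n$ ($n\ge 0$), $H$ an atom, $L_i$ literals. A (general) query is a finite, possibly empty, sequence of literals. A (general) program is a finite set of clauses. $\mathit{rel}(L)$ is the predicate symbol of $L$. $B_P$ is the set of ground atoms whose predicate symbol occurs in $P$. **LDNF-resolution (leftmost selection rule).** For a program $P$ and a non-empty query $Q=L,\mathbf{L}$: (i) if $L=A$ is an atom, the resolvents of $Q$ are the queries $(\mathbf{B},\mathbf{L})\theta$ for $H\leftarrow\mathbf{B}$ a variant of a clause of $P$ renamed apart from $Q$ and $\theta=\mathrm{mgu}(A,H)$; (ii) if $L=\neg A$ with $A$ ground, a subsidiary LDNF-tree for $P\cup\{A\}$ is constructed; if this tree is finite and finitely failed, $Q$ has the single resolvent $\mathbf{L}$; if it is finite and has a successful branch, $Q$ fails; if its construction diverges, the derivation containing $Q$ is considered infinite; (iii) if $L=\neg A$ with $A$ non-ground, the derivation flounders: it ends with no resolvent. A branch is successful if it ends in the empty query;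 it is failed if it ends in a query whose first literal is positive with no resolvent, or negative and ground with a finite subsidiary tree having a successful branch. A tree is finitely failed if it is finite and all its branches are failed. The LDNF-descendants of $P\cup\{Q\}$ are all queries occurring during LDNF-resolution of $P\cup\{Q\}$, including $Q$ itself and all queries occurring in the construction of all (nested) subsidiary LDNF-trees (including their roots). $\mathit{first}(Q)$ is the first literal of a non-empty query, and $\mathit{Call}_P(Q)=\{\mathit{first}(Q') : Q' \text{ a (non-empty) LDNF-descendant of } P\cup\{Q\}\}$. **Types.** A type is a set of terms closed under substitution. Every $n$-ary predicate $p$ has a fixed mode $m_p:\{1,\ldots,n\}\to\{+,-\}$ ($+$ input, $-$ output position) and a fixed assignment $t_p$ of a type to each position. A type judgement $\mathbf{s}:\mathbf{S}\Rightarrow\mathbf{t}:\mathbf{T}$ is true, written $\models\mathbf{s}:\mathbf{S}\Rightarrow\mathbf{t}:\mathbf{T}$, if for all substitutions $\theta$, $\mathbf{s}\theta\in\mathbf{S}$ implies $\mathbf{t}\theta\in\mathbf{T}$ (componentwise). For a literal $L_s$ (positive or negative), $\mathbf{i}_s:\mathbf{I}_s$ and $\mathbf{o}_s:\mathbf{O}_s$ denote the sequences of terms, with the associated types, in its input and output positions. A query $L_1,\ldots,L_n$ is well-typed if for all $j\in\{1,\ldots,n\}$, $\models\mathbf{o}_{j_1}:\mathbf{O}_{j_1},\ldots,\mathbf{o}_{j_k}:\mathbf{O}_{j_k}\Rightarrow\mathbf{i}_j:\mathbf{I}_j$, where $L_{j_1},\ldots,L_{j_k}$ are all the positive literals in $L_1,\ldots,L_{j-1}$.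 A clause $L_0\leftarrow L_1,\ldots,L_n$ is well-typed if for all $j\in\{1,\ldots,n\}$, $\models\mathbf{i}_0:\mathbf{I}_0,\mathbf{o}_{j_1}:\mathbf{O}_{j_1},\ldots,\mathbf{o}_{j_k}:\mathbf{O}_{j_k}\Rightarrow\mathbf{i}_j:\mathbf{I}_j$, where $L_{j_1},\ldots,L_{j_k}$ are all the positive literals in $L_1,\ldots,L_{j-1}$, and moreover $\models\mathbf{i}_0:\mathbf{I}_0,\mathbf{o}_{j_1}:\mathbf{O}_{j_1},\ldots,\mathbf{o}_{j_h}:\mathbf{O}_{j_h}\Rightarrow\mathbf{o}_0:\mathbf{O}_0$, where $L_{j_1},\ldots,L_{j_h}$ are all the positive literals in $L_1,\ldots,L_n$. A program is well-typed if all its clauses are. A well-typed atom is an atom which is well-typed as a one-literal query. **Level mappings, boundedness.** A level mapping for $P$ is a function $|\ |:B_P\to\mathbf{N}$, extended to ground literals by $|\neg A|=|A|$. An atom $A$ is bounded w.r.t. $|\ |$ if $\{|A'| : A' \text{ a ground instance of } A\}$ is finite. **Hierarchy.** A relation is defined in $P$ if it occurs in the head of a clause of $P$; a literal $L$ is defined in $P$ if $\mathit{rel}(L)$ is. $P$ extends $R$, written $P\sqsupset R$, if no relation defined in $P$ occurs in $R$. $R_n\sqsupset\cdots\sqsupset R_1$ is a hierarchy if $R_{i+1}\sqsupset(R_1\cup\cdots\cup R_i)$ for all $i\in\{1,\ldots,n-1\}$. **Strong boundedness.** For such a hierarchy with $P=R_1\cup\ldots\cup R_n$ and level mappings $|\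 |_i$ for $R_i$, a query $Q$ is strongly bounded w.r.t. $P$ and $|\ |_1,\ldots,|\ |_n$ if for all atoms $A\in\mathit{Call}_P(Q)$ and all $i\in\{1,\ldots,n\}$, if $A$ is defined in $R_i$ then $A$ is bounded w.r.t. $|\ |_i$. *)

theory Defs
  imports Main
begin

section \<open>Syntax\<close>

datatype 'f trm = Var nat | Fun 'f "'f trm list"

datatype ('f, 'p) atom = Atom (rel: 'p) (args: "'f trm list")

datatype ('f, 'p) literal = Pos "('f, 'p) atom" | Neg "('f, 'p) atom"

type_synonym ('f, 'p) query = "('f, 'p) literal list"

datatype ('f, 'p) clause = Clause (head: "('f, 'p) atom") (body: "('f, 'p) query")

type_synonym ('f, 'p) program = "('f, 'p) clause set"

fun atom_of :: "('f, 'p) literal \<Rightarrow> ('f, 'p) atom" where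
  "atom_of (Pos A) = A"
| "atom_of (Neg A) = A"

fun is_pos :: "('f, 'p) literal \<Rightarrow> bool" where
  "is_pos (Pos A) = True"
| "is_pos (Neg A) = False"

datatype mode = In | Out

text \<open>The symbols of the language are the elements of \<^typ>\<open>'f\<close> and \<^typ>\<open>'p\<close>. The mode and type
  assignments are part of the fixed data; argument positions are counted from 0, and only the
  positions below the arity matter.\<close>

record ('f, 'p) language =
  fun_arity :: "'f \<Rightarrow> nat"
  pred_arity :: "'p \<Rightarrow> nat"
  pred_mode :: "'p \<Rightarrow> nat \<Rightarrow> mode"
  pred_type :: "'p \<Rightarrow> nat \<Rightarrow> 'f trm set"

fun wf_trm :: "('f, 'p) language \<Rightarrow> 'f trm \<Rightarrow> bool" where
  "wf_trm \<Sigma> (Var x) = True"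
| "wf_trm \<Sigma> (Fun f ts) = (length ts = fun_arity \<Sigma> f \<and> (\<forall>t\<in>set ts. wf_trm \<Sigma> t))"

definition wf_atom :: "('f, 'p) language \<Rightarrow> ('f, 'p) atom \<Rightarrow> bool" where
  "wf_atom \<Sigma> A \<longleftrightarrow> length (args A) = pred_arity \<Sigma> (rel A) \<and> (\<forall>t\<in>set (args A). wf_trm \<Sigma> t)"

definition wf_query :: "('f, 'p) language \<Rightarrow> ('f, 'p) query \<Rightarrow> bool" where
  "wf_query \<Sigma> Q \<longleftrightarrow> (\<forall>L\<in>set Q. wf_atom \<Sigma> (atom_of L))"

definition wf_program :: "('f, 'p) language \<Rightarrow> ('f, 'p) program \<Rightarrow> bool" where
  "wf_program \<Sigma> P \<longleftrightarrow> finite P \<and> (\<forall>c\<in>P. wf_atom \<Sigma> (head c) \<and> wf_query \<Sigma> (body c))"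

section \<open>Substitutions\<close>

fun vars_trm :: "'f trm \<Rightarrow> nat set" where
  "vars_trm (Var x) = {x}"
| "vars_trm (Fun f ts) = (\<Union>t\<in>set ts. vars_trm t)"

definition vars_atom :: "('f, 'p) atom \<Rightarrow> nat set" where
  "vars_atom A = (\<Union>t\<in>set (args A). vars_trm t)"

definition vars_query :: "('f, 'p) query \<Rightarrow> nat set" where
  "vars_query Q = (\<Union>L\<in>set Q. vars_atom (atom_of L))"

definition vars_clause :: "('f, 'p) clause \<Rightarrow> nat set" where
  "vars_clause c = vars_atom (head c) \<union> vars_query (body c)"

abbreviation ground :: "('f, 'p) atom \<Rightarrow> bool" where
  "ground A \<equiv> vars_atom A = {}"

definition is_subst :: "('f, 'p) language \<Rightarrow> (nat \<Rightarrow> 'f trm) \<Rightarrow> bool" where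
  "is_subst \<Sigma> \<theta> \<longleftrightarrow> finite {x. \<theta> x \<noteq> Var x} \<and> (\<forall>x. wf_trm \<Sigma> (\<theta> x))"

fun subst_trm :: "'f trm \<Rightarrow> (nat \<Rightarrow> 'f trm) \<Rightarrow> 'f trm" where
  "subst_trm (Var x) \<theta> = \<theta> x"
| "subst_trm (Fun f ts) \<theta> = Fun f (map (\<lambda>t. subst_trm t \<theta>) ts)"

definition subst_atom :: "('f, 'p) atom \<Rightarrow> (nat \<Rightarrow> 'f trm) \<Rightarrow> ('f, 'p) atom" where
  "subst_atom A \<theta> = Atom (rel A) (map (\<lambda>t. subst_trm t \<theta>) (args A))"

fun subst_literal :: "('f, 'p) literal \<Rightarrow> (nat \<Rightarrow> 'f trm) \<Rightarrow> ('f, 'p) literal" where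
  "subst_literal (Pos A) \<theta> = Pos (subst_atom A \<theta>)"
| "subst_literal (Neg A) \<theta> = Neg (subst_atom A \<theta>)"

definition subst_query :: "('f, 'p) query \<Rightarrow> (nat \<Rightarrow> 'f trm) \<Rightarrow> ('f, 'p) query" where
  "subst_query Q \<theta> = map (\<lambda>L. subst_literal L \<theta>) Q"

definition subst_clause :: "('f, 'p) clause \<Rightarrow> (nat \<Rightarrow> 'f trm) \<Rightarrow> ('f, 'p) clause" where
  "subst_clause c \<theta> = Clause (subst_atom (head c) \<theta>) (subst_query (body c) \<theta>)"

definition is_mgu ::
  "('f, 'p) language \<Rightarrow> (nat \<Rightarrow> 'f trm) \<Rightarrow> ('f, 'p) atom \<Rightarrow> ('f, 'p) atom \<Rightarrow> bool" where
  "is_mgu \<Sigma> \<theta> A H \<longleftrightarrow>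
     is_subst \<Sigma> \<theta> \<and> subst_atom A \<theta> = subst_atom H \<theta> \<and>
     (\<forall>\<sigma>. is_subst \<Sigma> \<sigma> \<and> subst_atom A \<sigma> = subst_atom H \<sigma> \<longrightarrow>
        (\<exists>\<gamma>. is_subst \<Sigma> \<gamma> \<and> (\<forall>x. \<sigma> x = subst_trm (\<theta> x) \<gamma>)))"

definition is_variant :: "('f, 'p) clause \<Rightarrow> ('f, 'p) clause \<Rightarrow> bool" where
  "is_variant c' c \<longleftrightarrow>
     (\<exists>\<pi>. bij \<pi> \<and> finite {x. \<pi> x \<noteq> x} \<and> c' = subst_clause c (\<lambda>x. Var (\<pi> x)))"

section \<open>LDNF-resolution\<close>

definition resolvent ::
  "('f, 'p) language \<Rightarrow> ('f, 'p) clause \<Rightarrow> ('f, 'p) atom \<Rightarrow> ('f, 'p) query \<Rightarrow> ('f, 'p) query \<Rightarrow> bool"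
where
  "resolvent \<Sigma> c A Ls Q' \<longleftrightarrow>
     (\<exists>c' \<theta>. is_variant c' c \<and> vars_clause c' \<inter> vars_query (Pos A # Ls) = {} \<and>
             is_mgu \<Sigma> \<theta> A (head c') \<and> Q' = subst_query (body c' @ Ls) \<theta>)"

text \<open>Possibly infinite trees of queries. A node whose query starts with a positive literal has at
  most one child per program clause. A node whose query starts with a negative ground literal
  carries its subsidiary tree and the tree of its single resolvent, if there is one. Subsidiary
  trees may be nested infinitely deep.\<close>

codatatype ('f, 'p) tree =
    SuccessNode
  | PosNode "('f, 'p) atom" "('f, 'p) query" "('f, 'p) clause \<Rightarrow> ('f, 'p) tree option"
  | NegNode "('f, 'p) atom" "('f, 'p) query" "('f, 'p) tree" "('f, 'p) tree option"
  | FlounderNode "('f, 'p) atom" "('f, 'p) query"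

definition root :: "('f, 'p) tree \<Rightarrow> ('f, 'p) query" where
  "root t = (case t of SuccessNode \<Rightarrow> []
     | PosNode A Ls ch \<Rightarrow> Pos A # Ls
     | NegNode A Ls s k \<Rightarrow> Neg A # Ls
     | FlounderNode A Ls \<Rightarrow> Neg A # Ls)"

text \<open>Finiteness includes the subsidiary trees: a derivation containing a query whose subsidiary
  tree diverges counts as infinite.\<close>

inductive finite_tree :: "('f, 'p) tree \<Rightarrow> bool" where
  "finite_tree SuccessNode"
| "finite (dom ch) \<Longrightarrow> (\<And>c t. ch c = Some t \<Longrightarrow> finite_tree t) \<Longrightarrow> finite_tree (PosNode A Ls ch)"
| "finite_tree s \<Longrightarrow> (\<And>t. k = Some t \<Longrightarrow> finite_tree t) \<Longrightarrow> finite_tree (NegNode A Ls s k)"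
| "finite_tree (FlounderNode A Ls)"

text \<open>\<open>branch_end t l\<close>: some finite branch of the main tree of \<open>t\<close> ends in the leaf \<open>l\<close>. Branches do
  not enter subsidiary trees.\<close>

inductive branch_end :: "('f, 'p) tree \<Rightarrow> ('f, 'p) tree \<Rightarrow> bool" where
  "branch_end SuccessNode SuccessNode"
| "branch_end (PosNode A Ls Map.empty) (PosNode A Ls Map.empty)"
| "ch c = Some t \<Longrightarrow> branch_end t l \<Longrightarrow> branch_end (PosNode A Ls ch) l"
| "branch_end (NegNode A Ls s None) (NegNode A Ls s None)"
| "branch_end t l \<Longrightarrow> branch_end (NegNode A Ls s (Some t)) l"
| "branch_end (FlounderNode A Ls) (FlounderNode A Ls)"

definition has_successful_branch :: "('f, 'p) tree \<Rightarrow> bool" where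
  "has_successful_branch t \<longleftrightarrow> branch_end t SuccessNode"

definition failed_leaf :: "('f, 'p) tree \<Rightarrow> bool" where
  "failed_leaf l \<longleftrightarrow>
     (\<exists>A Ls. l = PosNode A Ls Map.empty) \<or>
     (\<exists>A Ls s. l = NegNode A Ls s None \<and> finite_tree s \<and> has_successful_branch s)"

definition finitely_failed :: "('f, 'p) tree \<Rightarrow> bool" where
  "finitely_failed t \<longleftrightarrow> finite_tree t \<and> (\<forall>l. branch_end t l \<longrightarrow> failed_leaf l)"

text \<open>\<open>ldnf_tree \<Sigma> P Q t\<close>: \<open>t\<close> is an LDNF-tree for \<open>P \<union> {Q}\<close>. A query has several such trees,
  depending on the choice of clause variants and mgus. A query that starts with a negative ground
  literal has no resolvent if its subsidiary tree is finite with a successful branch, if that tree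
  diverges, or if it is finite and flounders without a successful branch; only the first case makes
  the node a failed leaf.\<close>

coinductive ldnf_tree ::
  "('f, 'p) language \<Rightarrow> ('f, 'p) program \<Rightarrow> ('f, 'p) query \<Rightarrow> ('f, 'p) tree \<Rightarrow> bool"
  for \<Sigma> P
where
  success: "ldnf_tree \<Sigma> P [] SuccessNode"
| pos: "(\<And>c t. ch c = Some t \<Longrightarrow> c \<in> P \<and> (\<exists>Q'. resolvent \<Sigma> c A Ls Q' \<and> ldnf_tree \<Sigma> P Q' t)) \<Longrightarrow>
    (\<And>c. c \<in> P \<Longrightarrow> ch c = None \<Longrightarrow> \<nexists>Q'. resolvent \<Sigma> c A Ls Q') \<Longrightarrow>
    ldnf_tree \<Sigma> P (Pos A # Ls) (PosNode A Ls ch)"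
| neg_continue: "ground A \<Longrightarrow> ldnf_tree \<Sigma> P [Pos A] s \<Longrightarrow> finitely_failed s \<Longrightarrow> ldnf_tree \<Sigma> P Ls t \<Longrightarrow>
    ldnf_tree \<Sigma> P (Neg A # Ls) (NegNode A Ls s (Some t))"
| neg_stop: "ground A \<Longrightarrow> ldnf_tree \<Sigma> P [Pos A] s \<Longrightarrow> \<not> finitely_failed s \<Longrightarrow>
    ldnf_tree \<Sigma> P (Neg A # Ls) (NegNode A Ls s None)"
| flounder: "\<not> ground A \<Longrightarrow> ldnf_tree \<Sigma> P (Neg A # Ls) (FlounderNode A Ls)"

text \<open>\<open>occurs_in u t\<close>: \<open>u\<close> is a node of \<open>t\<close> or of one of the nested subsidiary trees of \<open>t\<close>.\<close>

inductive occurs_in :: "('f, 'p) tree \<Rightarrow> ('f, 'p) tree \<Rightarrow> bool" where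
  "occurs_in t t"
| "ch c = Some t \<Longrightarrow> occurs_in u t \<Longrightarrow> occurs_in u (PosNode A Ls ch)"
| "occurs_in u s \<Longrightarrow> occurs_in u (NegNode A Ls s k)"
| "occurs_in u t \<Longrightarrow> occurs_in u (NegNode A Ls s (Some t))"

definition ldnf_descendants ::
  "('f, 'p) language \<Rightarrow> ('f, 'p) program \<Rightarrow> ('f, 'p) query \<Rightarrow> ('f, 'p) query set" where
  "ldnf_descendants \<Sigma> P Q = {root u | u t. ldnf_tree \<Sigma> P Q t \<and> occurs_in u t}"

definition Call ::
  "('f, 'p) language \<Rightarrow> ('f, 'p) program \<Rightarrow> ('f, 'p) query \<Rightarrow> ('f, 'p) literal set" where
  "Call \<Sigma> P Q = {hd Q' | Q'. Q' \<in> ldnf_descendants \<Sigma> P Q \<and> Q' \<noteq> []}"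

section \<open>Types\<close>

definition is_type :: "('f, 'p) language \<Rightarrow> 'f trm set \<Rightarrow> bool" where
  "is_type \<Sigma> T \<longleftrightarrow>
     (\<forall>t\<in>T. wf_trm \<Sigma> t) \<and> (\<forall>t\<in>T. \<forall>\<theta>. is_subst \<Sigma> \<theta> \<longrightarrow> subst_trm t \<theta> \<in> T)"

definition wf_language :: "('f, 'p) language \<Rightarrow> bool" where
  "wf_language \<Sigma> \<longleftrightarrow>
     (\<exists>f. fun_arity \<Sigma> f = 0) \<and> (\<forall>p. \<forall>k<pred_arity \<Sigma> p. is_type \<Sigma> (pred_type \<Sigma> p k))"

text \<open>A typed sequence of terms is a list of term/type pairs.\<close>

definition judgement ::
  "('f, 'p) language \<Rightarrow> ('f trm \<times> 'f trm set) list \<Rightarrow> ('f trm \<times> 'f trm set) list \<Rightarrow> bool" where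
  "judgement \<Sigma> \<Gamma> \<Delta> \<longleftrightarrow>
     (\<forall>\<theta>. is_subst \<Sigma> \<theta> \<longrightarrow>
        (\<forall>(s, S)\<in>set \<Gamma>. subst_trm s \<theta> \<in> S) \<longrightarrow> (\<forall>(t, T)\<in>set \<Delta>. subst_trm t \<theta> \<in> T))"

definition positions ::
  "('f, 'p) language \<Rightarrow> mode \<Rightarrow> ('f, 'p) atom \<Rightarrow> ('f trm \<times> 'f trm set) list" where
  "positions \<Sigma> m A =
     [(args A ! k, pred_type \<Sigma> (rel A) k).
        k \<leftarrow> [0..<pred_arity \<Sigma> (rel A)], pred_mode \<Sigma> (rel A) k = m]"

definition pos_outputs ::
  "('f, 'p) language \<Rightarrow> ('f, 'p) query \<Rightarrow> ('f trm \<times> 'f trm set) list" where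
  "pos_outputs \<Sigma> Ls = concat (map (\<lambda>L. positions \<Sigma> Out (atom_of L)) (filter is_pos Ls))"

definition well_typed_query :: "('f, 'p) language \<Rightarrow> ('f, 'p) query \<Rightarrow> bool" where
  "well_typed_query \<Sigma> Q \<longleftrightarrow>
     (\<forall>j<length Q. judgement \<Sigma> (pos_outputs \<Sigma> (take j Q)) (positions \<Sigma> In (atom_of (Q ! j))))"

definition well_typed_clause :: "('f, 'p) language \<Rightarrow> ('f, 'p) clause \<Rightarrow> bool" where
  "well_typed_clause \<Sigma> c \<longleftrightarrow>
     (\<forall>j<length (body c).
        judgement \<Sigma> (positions \<Sigma> In (head c) @ pos_outputs \<Sigma> (take j (body c)))
          (positions \<Sigma> In (atom_of (body c ! j)))) \<and>
     judgement \<Sigma> (positions \<Sigma> In (head c) @ pos_outputs \<Sigma> (body c)) (positions \<Sigma> Out (head c))"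

definition well_typed_program :: "('f, 'p) language \<Rightarrow> ('f, 'p) program \<Rightarrow> bool" where
  "well_typed_program \<Sigma> P \<longleftrightarrow> (\<forall>c\<in>P. well_typed_clause \<Sigma> c)"

definition well_typed_atom :: "('f, 'p) language \<Rightarrow> ('f, 'p) atom \<Rightarrow> bool" where
  "well_typed_atom \<Sigma> A \<longleftrightarrow> well_typed_query \<Sigma> [Pos A]"

section \<open>Hierarchies and boundedness\<close>

definition rels_clause :: "('f, 'p) clause \<Rightarrow> 'p set" where
  "rels_clause c = insert (rel (head c)) ((\<lambda>L. rel (atom_of L)) ` set (body c))"

definition rels :: "('f, 'p) program \<Rightarrow> 'p set" where
  "rels P = (\<Union>c\<in>P. rels_clause c)"

definition defined_rels :: "('f, 'p) program \<Rightarrow> 'p set" where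
  "defined_rels P = (\<lambda>c. rel (head c)) ` P"

definition extends :: "('f, 'p) program \<Rightarrow> ('f, 'p) program \<Rightarrow> bool" where
  "extends P R \<longleftrightarrow> defined_rels P \<inter> rels R = {}"

definition hierarchy :: "nat \<Rightarrow> (nat \<Rightarrow> ('f, 'p) program) \<Rightarrow> bool" where
  "hierarchy n R \<longleftrightarrow> (\<forall>i\<in>{1..<n}. extends (R (Suc i)) (\<Union>j\<in>{1..i}. R j))"

text \<open>A level mapping for \<open>P\<close> is represented by a total function on atoms of which only the values
  on the ground atoms with a predicate symbol of \<open>P\<close> are used: boundedness with respect to it is
  only ever considered for atoms whose relation is defined in \<open>P\<close>.\<close>

type_synonym ('f, 'p) level_mapping = "('f, 'p) atom \<Rightarrow> nat"

definition ground_instances :: "('f, 'p) language \<Rightarrow> ('f, 'p) atom \<Rightarrow> ('f, 'p) atom set" where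
  "ground_instances \<Sigma> A = {subst_atom A \<theta> | \<theta>. is_subst \<Sigma> \<theta> \<and> ground (subst_atom A \<theta>)}"

definition bounded :: "('f, 'p) language \<Rightarrow> ('f, 'p) level_mapping \<Rightarrow> ('f, 'p) atom \<Rightarrow> bool" where
  "bounded \<Sigma> lv A \<longleftrightarrow> finite (lv ` ground_instances \<Sigma> A)"

definition strongly_bounded ::
  "('f, 'p) language \<Rightarrow> nat \<Rightarrow> (nat \<Rightarrow> ('f, 'p) program) \<Rightarrow> (nat \<Rightarrow> ('f, 'p) level_mapping) \<Rightarrow>
   ('f, 'p) query \<Rightarrow> bool" where
  "strongly_bounded \<Sigma> n R lv Q \<longleftrightarrow>
     (\<forall>A. Pos A \<in> Call \<Sigma> (\<Union>i\<in>{1..n}. R i) Q \<longrightarrow>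
        (\<forall>i\<in>{1..n}. rel A \<in> defined_rels (R i) \<longrightarrow> bounded \<Sigma> (lv i) A))"

end

(* Whether a judgement holds at a fixed substitution \<sigma> only depends on the atoms instantiated by \<sigma>.
   So a well-typed query is one all of whose instances Q have the pointwise property "correct":
   each literal has typed inputs as soon as the positive literals before it have typed outputs.
   In a resolution step the selected atom A has typed inputs; as A and the clause head have a common
   instance, the body is correct and its outputs type those of A, which the rest of the query
   needs. Negative literals produce no outputs, so dropping one is harmless, and a subsidiary tree
   starts from a first literal, whose inputs are typed unconditionally. Hence all LDNF-descendants
   of a well-typed query are well-typed, and so are the atoms among their first literals. *)
theory Submission
  imports Defs
begin

section \<open>Composition of substitutions\<close>

definition comp_subst :: "(nat \<Rightarrow> 'f trm) \<Rightarrow> (nat \<Rightarrow> 'f trm) \<Rightarrow> nat \<Rightarrow> 'f trm" where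
  "comp_subst \<theta> \<sigma> = (\<lambda>x. subst_trm (\<theta> x) \<sigma>)"

lemma subst_trm_comp: "subst_trm (subst_trm t \<theta>) \<sigma> = subst_trm t (comp_subst \<theta> \<sigma>)"
  by (induction t) (auto simp: comp_subst_def)

lemma subst_atom_comp: "subst_atom (subst_atom A \<theta>) \<sigma> = subst_atom A (comp_subst \<theta> \<sigma>)"
  by (simp add: subst_atom_def subst_trm_comp)

lemma subst_literal_comp:
  "subst_literal (subst_literal L \<theta>) \<sigma> = subst_literal L (comp_subst \<theta> \<sigma>)"
  by (cases L) (simp_all add: subst_atom_comp)

lemma subst_query_comp: "subst_query (subst_query Q \<theta>) \<sigma> = subst_query Q (comp_subst \<theta> \<sigma>)"
  by (simp add: subst_query_def subst_literal_comp)

lemma wf_trm_subst: "wf_trm \<Sigma> t \<Longrightarrow> is_subst \<Sigma> \<theta> \<Longrightarrow> wf_trm \<Sigma> (subst_trm t \<theta>)"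
  by (induction t) (auto simp: is_subst_def)

lemma wf_atom_subst: "wf_atom \<Sigma> A \<Longrightarrow> is_subst \<Sigma> \<theta> \<Longrightarrow> wf_atom \<Sigma> (subst_atom A \<theta>)"
  by (auto simp: wf_atom_def subst_atom_def wf_trm_subst)

lemma atom_of_subst [simp]: "atom_of (subst_literal L \<theta>) = subst_atom (atom_of L) \<theta>"
  by (cases L) simp_all

lemma is_pos_subst [simp]: "is_pos (subst_literal L \<theta>) = is_pos L"
  by (cases L) simp_all

lemma wf_query_subst: "wf_query \<Sigma> Q \<Longrightarrow> is_subst \<Sigma> \<theta> \<Longrightarrow> wf_query \<Sigma> (subst_query Q \<theta>)"
  by (auto simp: wf_query_def subst_query_def wf_atom_subst)

lemma is_subst_comp:
  assumes "is_subst \<Sigma> \<theta>" "is_subst \<Sigma> \<sigma>"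
  shows "is_subst \<Sigma> (comp_subst \<theta> \<sigma>)"
proof -
  have "{x. comp_subst \<theta> \<sigma> x \<noteq> Var x} \<subseteq> {x. \<theta> x \<noteq> Var x} \<union> {x. \<sigma> x \<noteq> Var x}"
    by (auto simp: comp_subst_def)
  moreover have "finite ({x. \<theta> x \<noteq> Var x} \<union> {x. \<sigma> x \<noteq> Var x})"
    using assms by (simp add: is_subst_def)
  ultimately have "finite {x. comp_subst \<theta> \<sigma> x \<noteq> Var x}"
    by (rule finite_subset)
  then show ?thesis
    using assms by (simp add: is_subst_def comp_subst_def wf_trm_subst)
qed

section \<open>Pointwise typing\<close>

text \<open>No substitution occurs here: a judgement quantifies over substitutions, and
  \<open>typed\<close> is what remains of one of its sides, for one atom, once the substitution has
  been applied.\<close>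

definition typed :: "('f, 'p) language \<Rightarrow> mode \<Rightarrow> ('f, 'p) atom \<Rightarrow> bool" where
  "typed \<Sigma> m A \<longleftrightarrow>
     (\<forall>k<pred_arity \<Sigma> (rel A). pred_mode \<Sigma> (rel A) k = m \<longrightarrow> args A ! k \<in> pred_type \<Sigma> (rel A) k)"

definition typed_outputs :: "('f, 'p) language \<Rightarrow> ('f, 'p) query \<Rightarrow> bool" where
  "typed_outputs \<Sigma> Q \<longleftrightarrow> (\<forall>L\<in>set Q. is_pos L \<longrightarrow> typed \<Sigma> Out (atom_of L))"

text \<open>Recursion from the left mirrors the leftmost selection rule: removing the first literal
  leaves \<open>correct\<close> of the tail. For a negative literal the guard is vacuous, so the
  tail is correct outright.\<close>

fun correct :: "('f, 'p) language \<Rightarrow> ('f, 'p) query \<Rightarrow> bool" where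
  "correct \<Sigma> [] \<longleftrightarrow> True"
| "correct \<Sigma> (L # Ls) \<longleftrightarrow>
     typed \<Sigma> In (atom_of L) \<and> ((is_pos L \<longrightarrow> typed \<Sigma> Out (atom_of L)) \<longrightarrow> correct \<Sigma> Ls)"

text \<open>Serves to split a resolvent into the instantiated clause body and the rest of the
  query.\<close>

lemma correct_append:
  "correct \<Sigma> (Q @ Q') \<longleftrightarrow> correct \<Sigma> Q \<and> (typed_outputs \<Sigma> Q \<longrightarrow> correct \<Sigma> Q')"
  by (induction Q) (auto simp: typed_outputs_def)

text \<open>Links the recursion to the indexed form used in the definitions of well-typedness; index
  0 is the head, and a successor index adds the head to the prefix taken from the tail.\<close>

lemma correct_iff_nth:
  "correct \<Sigma> Q \<longleftrightarrow>
     (\<forall>j<length Q. typed_outputs \<Sigma> (take j Q) \<longrightarrow> typed \<Sigma> In (atom_of (Q ! j)))"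
  by (induction Q) (auto simp: typed_outputs_def All_less_Suc2)

text \<open>Well-formedness makes every position below the arity a valid index, so that
  \<open>nth\<close> commutes with mapping the substitution over the arguments.\<close>

lemma satisfies_positions_iff:
  assumes "wf_atom \<Sigma> A"
  shows "(\<forall>(s, S)\<in>set (positions \<Sigma> m A). subst_trm s \<theta> \<in> S) \<longleftrightarrow> typed \<Sigma> m (subst_atom A \<theta>)"
  using assms by (auto simp: positions_def typed_def subst_atom_def wf_atom_def)

lemma satisfies_pos_outputs_iff:
  assumes "wf_query \<Sigma> Q"
  shows "(\<forall>(s, S)\<in>set (pos_outputs \<Sigma> Q). subst_trm s \<theta> \<in> S) \<longleftrightarrow>
    typed_outputs \<Sigma> (subst_query Q \<theta>)"
proof -
  have "(\<forall>(s, S)\<in>set (pos_outputs \<Sigma> Q). subst_trm s \<theta> \<in> S) \<longleftrightarrow>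
    (\<forall>L\<in>set Q. is_pos L \<longrightarrow> (\<forall>(s, S)\<in>set (positions \<Sigma> Out (atom_of L)). subst_trm s \<theta> \<in> S))"
    by (auto simp: pos_outputs_def)
  also have "\<dots> \<longleftrightarrow> typed_outputs \<Sigma> (subst_query Q \<theta>)"
    using assms
    by (simp add: satisfies_positions_iff wf_query_def typed_outputs_def subst_query_def)
  finally show ?thesis .
qed

lemma wf_query_take: "wf_query \<Sigma> Q \<Longrightarrow> wf_query \<Sigma> (take j Q)"
  by (auto simp: wf_query_def dest: in_set_takeD)

lemma wf_query_nth: "wf_query \<Sigma> Q \<Longrightarrow> j < length Q \<Longrightarrow> wf_atom \<Sigma> (atom_of (Q ! j))"
  by (simp add: wf_query_def)

lemma correct_subst_iff:
  assumes "wf_query \<Sigma> Q"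
  shows "correct \<Sigma> (subst_query Q \<theta>) \<longleftrightarrow>
    (\<forall>j<length Q. (\<forall>(s, S)\<in>set (pos_outputs \<Sigma> (take j Q)). subst_trm s \<theta> \<in> S) \<longrightarrow>
       (\<forall>(t, T)\<in>set (positions \<Sigma> In (atom_of (Q ! j))). subst_trm t \<theta> \<in> T))"
  unfolding correct_iff_nth
  by (simp add: satisfies_pos_outputs_iff[OF wf_query_take[OF assms]]
      satisfies_positions_iff[OF wf_query_nth[OF assms]] subst_query_def take_map)

text \<open>After \<open>correct_subst_iff\<close> the two sides differ only in the order of the
  quantifiers over \<theta> and over the index of the literal.\<close>

lemma well_typed_query_iff:
  assumes "wf_query \<Sigma> Q"
  shows "well_typed_query \<Sigma> Q \<longleftrightarrow> (\<forall>\<theta>. is_subst \<Sigma> \<theta> \<longrightarrow> correct \<Sigma> (subst_query Q \<theta>))"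
  unfolding correct_subst_iff[OF assms] well_typed_query_def judgement_def by blast

text \<open>The head inputs are premises of every judgement of the clause. Once they hold at
  \<theta>, the body behaves like a query at \<theta>, and its outputs carry over to the
  head.\<close>

lemma well_typed_clauseD:
  assumes "well_typed_clause \<Sigma> c" "wf_atom \<Sigma> (head c)" "wf_query \<Sigma> (body c)" "is_subst \<Sigma> \<theta>"
    and "typed \<Sigma> In (subst_atom (head c) \<theta>)"
  shows "correct \<Sigma> (subst_query (body c) \<theta>)"
    and "typed_outputs \<Sigma> (subst_query (body c) \<theta>) \<Longrightarrow> typed \<Sigma> Out (subst_atom (head c) \<theta>)"
proof -
  have hd: "\<forall>(s, S)\<in>set (positions \<Sigma> In (head c)). subst_trm s \<theta> \<in> S"
    using assms(2,5) by (simp add: satisfies_positions_iff)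
  show "correct \<Sigma> (subst_query (body c) \<theta>)"
    unfolding correct_subst_iff[OF assms(3)]
    using assms(1,4) hd unfolding well_typed_clause_def judgement_def set_append ball_Un by blast
  assume "typed_outputs \<Sigma> (subst_query (body c) \<theta>)"
  then have "\<forall>(s, S)\<in>set (pos_outputs \<Sigma> (body c)). subst_trm s \<theta> \<in> S"
    using assms(3) by (simp add: satisfies_pos_outputs_iff)
  then have "\<forall>(t, T)\<in>set (positions \<Sigma> Out (head c)). subst_trm t \<theta> \<in> T"
    using assms(1,4) hd unfolding well_typed_clause_def judgement_def set_append ball_Un by blast
  then show "typed \<Sigma> Out (subst_atom (head c) \<theta>)"
    using assms(2) by (simp add: satisfies_positions_iff)
qed

section \<open>Persistence of well-typedness\<close>

lemma is_subst_renaming: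
  assumes "finite {x. \<pi> x \<noteq> x}"
  shows "is_subst \<Sigma> (\<lambda>x. Var (\<pi> x))"
  using assms by (simp add: is_subst_def)

lemma resolvent_well_typed:
  assumes res: "resolvent \<Sigma> c A Ls Q'"
    and c: "well_typed_clause \<Sigma> c" "wf_atom \<Sigma> (head c)" "wf_query \<Sigma> (body c)"
    and wf: "wf_query \<Sigma> (Pos A # Ls)" and wt: "well_typed_query \<Sigma> (Pos A # Ls)"
  shows "wf_query \<Sigma> Q' \<and> well_typed_query \<Sigma> Q'"
proof -
  from res obtain \<pi> \<theta> where \<pi>: "finite {x. \<pi> x \<noteq> x}"
    and mgu: "is_mgu \<Sigma> \<theta> A (subst_atom (head c) (\<lambda>x. Var (\<pi> x)))"
    and Q': "Q' = subst_query (subst_query (body c) (\<lambda>x. Var (\<pi> x)) @ Ls) \<theta>"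
    by (auto simp: resolvent_def is_variant_def subst_clause_def)
  \<comment> \<open>Absorbing the renaming into the substitution makes the new body an instance of
    the program clause itself, so the typing of \<open>c\<close> applies without being transferred
    to its variant.\<close>
  define \<rho> where "\<rho> = comp_subst (\<lambda>x. Var (\<pi> x) :: 'a trm) \<theta>"
  have \<theta>: "is_subst \<Sigma> \<theta>" and unif: "subst_atom A \<theta> = subst_atom (head c) \<rho>"
    using mgu by (simp_all add: is_mgu_def subst_atom_comp \<rho>_def)
  have \<rho>: "is_subst \<Sigma> \<rho>"
    unfolding \<rho>_def by (intro is_subst_comp is_subst_renaming \<pi> \<theta>)
  have Q'_eq: "Q' = subst_query (body c) \<rho> @ subst_query Ls \<theta>"
    unfolding Q' \<rho>_def by (simp flip: subst_query_comp) (simp add: subst_query_def)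
  have "wf_query \<Sigma> Ls"
    using wf by (simp add: wf_query_def)
  then have wf': "wf_query \<Sigma> Q'"
    unfolding Q'_eq using wf_query_subst[OF c(3) \<rho>] wf_query_subst[of \<Sigma> Ls, OF _ \<theta>]
    by (auto simp: wf_query_def)
  moreover have "correct \<Sigma> (subst_query Q' \<sigma>)" if \<sigma>: "is_subst \<Sigma> \<sigma>" for \<sigma>
  proof -
    have "correct \<Sigma> (subst_query (Pos A # Ls) (comp_subst \<theta> \<sigma>))"
      using wt wf \<theta> \<sigma> by (simp add: well_typed_query_iff is_subst_comp)
    \<comment> \<open>This common instance passes types both ways: typed inputs from
      \<open>A\<close> to the head, typed outputs from the head back to \<open>A\<close>.\<close>
    moreover have "subst_atom A (comp_subst \<theta> \<sigma>) = subst_atom (head c) (comp_subst \<rho> \<sigma>)"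
      using unif by (simp flip: subst_atom_comp)
    ultimately have head: "typed \<Sigma> In (subst_atom (head c) (comp_subst \<rho> \<sigma>))"
      and rest: "typed \<Sigma> Out (subst_atom (head c) (comp_subst \<rho> \<sigma>)) \<Longrightarrow>
        correct \<Sigma> (subst_query Ls (comp_subst \<theta> \<sigma>))"
      by (simp_all add: subst_query_def)
    note clause = well_typed_clauseD[OF c is_subst_comp[OF \<rho> \<sigma>] head]
    have "subst_query Q' \<sigma> =
      subst_query (body c) (comp_subst \<rho> \<sigma>) @ subst_query Ls (comp_subst \<theta> \<sigma>)"
      unfolding Q'_eq by (simp flip: subst_query_comp) (simp add: subst_query_def)
    \<comment> \<open>The part from \<open>Ls\<close> may assume typed body outputs; by
      \<open>clause\<close> these type the head outputs, which is the premise of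
      \<open>rest\<close>.\<close>
    then show ?thesis
      using clause rest by (simp add: correct_append)
  qed
  ultimately show ?thesis
    by (simp add: well_typed_query_iff)
qed

text \<open>No literal precedes \<open>L\<close>, so its inputs are typed under every substitution,
  whatever its sign. This covers both called atoms and roots of subsidiary trees.\<close>

lemma well_typed_atom_hd:
  assumes "wf_query \<Sigma> (L # Ls)" "well_typed_query \<Sigma> (L # Ls)"
  shows "wf_atom \<Sigma> (atom_of L)" and "well_typed_atom \<Sigma> (atom_of L)"
proof -
  show wf: "wf_atom \<Sigma> (atom_of L)"
    using assms(1) by (simp add: wf_query_def)
  have "wf_query \<Sigma> [Pos (atom_of L)]"
    using wf by (simp add: wf_query_def)
  then show "well_typed_atom \<Sigma> (atom_of L)"
    using assms by (simp add: well_typed_atom_def well_typed_query_iff subst_query_def)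
qed

lemma well_typed_query_tl_Neg:
  assumes "wf_query \<Sigma> (Neg A # Ls)" "well_typed_query \<Sigma> (Neg A # Ls)"
  shows "wf_query \<Sigma> Ls \<and> well_typed_query \<Sigma> Ls"
proof -
  have "wf_query \<Sigma> Ls"
    using assms(1) by (simp add: wf_query_def)
  then show ?thesis
    using assms by (simp add: well_typed_query_iff subst_query_def)
qed

lemma root_ldnf_tree: "ldnf_tree \<Sigma> P Q t \<Longrightarrow> root t = Q"
  by (erule ldnf_tree.cases) (simp_all add: root_def)

text \<open>Although the tree may be infinite, each node is reached in finitely many steps, so
  induction on \<open>occurs_in\<close> suffices. \<open>Q\<close> is generalized because each step
  moves to a tree for another query.\<close>

lemma occurs_in_well_typed:
  assumes "occurs_in u t" and "wf_program \<Sigma> P" "well_typed_program \<Sigma> P"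
    and "ldnf_tree \<Sigma> P Q t" "wf_query \<Sigma> Q" "well_typed_query \<Sigma> Q"
  shows "wf_query \<Sigma> (root u) \<and> well_typed_query \<Sigma> (root u)"
  using assms
proof (induction arbitrary: Q rule: occurs_in.induct)
  case (1 t)
  then show ?case
    by (simp add: root_ldnf_tree)
next
  case (2 ch c t u A Ls)
  from "2.prems"(3) obtain Q' where Q: "Q = Pos A # Ls" and "c \<in> P"
    and res: "resolvent \<Sigma> c A Ls Q'" and t: "ldnf_tree \<Sigma> P Q' t"
    using "2.hyps"(1) by (cases rule: ldnf_tree.cases) blast
  have "wf_query \<Sigma> Q' \<and> well_typed_query \<Sigma> Q'"
    by (rule resolvent_well_typed[OF res])
      (use "2.prems" Q \<open>c \<in> P\<close> in \<open>auto simp: wf_program_def well_typed_program_def\<close>)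
  then show ?case
    using "2.IH" "2.prems"(1,2) t by blast
next
  case (3 u s A Ls k)
  \<comment> \<open>As \<open>k\<close> is arbitrary, the node may arise from
    \<open>neg_continue\<close> or \<open>neg_stop\<close>; both provide the subsidiary
    tree.\<close>
  from "3.prems"(3) have Q: "Q = Neg A # Ls" and s: "ldnf_tree \<Sigma> P [Pos A] s"
    by (cases rule: ldnf_tree.cases; simp)+
  have "wf_query \<Sigma> [Pos A]" "well_typed_query \<Sigma> [Pos A]"
    using well_typed_atom_hd[of \<Sigma> "Neg A" Ls] "3.prems"(4,5) Q
    by (simp_all add: wf_query_def well_typed_atom_def)
  then show ?case
    using "3.IH" "3.prems"(1,2) s by blast
next
  case (4 u t A Ls s)
  from "4.prems"(3) have Q: "Q = Neg A # Ls" and t: "ldnf_tree \<Sigma> P Ls t"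
    by (cases rule: ldnf_tree.cases; simp)+
  show ?case
    using "4.IH" "4.prems" t Q well_typed_query_tl_Neg by blast
qed

lemma Pos_in_Call_well_typed:
  assumes "Pos A \<in> Call \<Sigma> P Q" and "wf_program \<Sigma> P" "well_typed_program \<Sigma> P"
    and "wf_query \<Sigma> Q" "well_typed_query \<Sigma> Q"
  shows "wf_atom \<Sigma> A \<and> well_typed_atom \<Sigma> A"
proof -
  from assms(1) obtain u t where t: "ldnf_tree \<Sigma> P Q t" "occurs_in u t"
    and u: "Pos A = hd (root u)" "root u \<noteq> []"
    by (auto simp: Call_def ldnf_descendants_def)
  have "wf_query \<Sigma> (root u)" "well_typed_query \<Sigma> (root u)"
    using occurs_in_well_typed t assms by blast+
  moreover have "root u = Pos A # tl (root u)"
    using u by simp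
  ultimately show ?thesis
    using well_typed_atom_hd[of \<Sigma> "Pos A" "tl (root u)"] by simp
qed

theorem proposition31:
  fixes \<Sigma> :: "('f, 'p) language"
    and n :: nat
    and R :: "nat \<Rightarrow> ('f, 'p) program"
    and P :: "('f, 'p) program"
    and lv :: "nat \<Rightarrow> ('f, 'p) level_mapping"
  assumes "wf_language \<Sigma>"
    and "1 \<le> n"
    and "P = (\<Union>i\<in>{1..n}. R i)"
    and "wf_program \<Sigma> P"
    and "well_typed_program \<Sigma> P"
    and "hierarchy n R"
    and "\<And>A i. wf_atom \<Sigma> A \<Longrightarrow> well_typed_atom \<Sigma> A \<Longrightarrow> i \<in> {1..n} \<Longrightarrow>
           rel A \<in> defined_rels (R i) \<Longrightarrow> bounded \<Sigma> (lv i) A"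
  shows "\<forall>Q. wf_query \<Sigma> Q \<and> well_typed_query \<Sigma> Q \<longrightarrow> strongly_bounded \<Sigma> n R lv Q"
  using Pos_in_Call_well_typed assms(3-5,7) unfolding strongly_bounded_def by blast

end
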